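(* Let $G$ be a group, $H$ a subgroup of finite index $[G:H]$ in $G$, and $K$ a normal subgroup of $H$. Let $C$ be a proper subset of $H$ such that $C$ is a union of right cosets of $K$ and $H\setminus C$ is a union of finitely many right cosets of $K$. Assume that the number of right cosets of $K$ contained in $C$ is greater than $2[G:H]$ times the number of right cosets of $K$ contained in $H\setminus C$. Let $E$ be a finite subset of $C$ and $F$ a subset of $H\setminus C$. Consider the conditions: (2) for every subset $X$ of $H$ with $|X|\leq 2([G:H]+1)|E|$, the set $F\cup X$ does not contain any right coset of $K$; (3) the set $E\cdot F^{-1}$ does not contain any right coset of $K$. (i) If $(C^{-1}(H\setminus C))\cup((H\setminus C)^{-1}C)=H\setminus K$ and (2), (3) hold, then $(C\setminus E)\cup F$ is not a minimal complement in $G$. (ii) If every subgroup $K'$ of $H$ with $K\subseteq K'$ such that $H\setminus C$ is a union of right cosets of $K'$ is normal in $H$, and (2), (3) hold, then $(C\setminus E)\cup F$ is not a minimal complement in $G$.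
   Context: For nonempty subsets $A,B$ of a group $G$, write $A\cdot B=\{ab: a\in A, b\in B\}$ and $A^{-1}=\{a^{-1}:a\in A\}$. $A$ is a left complement to $B$ if $A\cdot B=G$, and a right complement to $B$ if $B\cdot A=G$. $A$ is a minimal left (resp. right) complement to $B$ if $A$ is a left (resp. right) complement to $B$ and no proper subset of $A$ is a left (resp. right) complement to $B$. A subset $A$ of $G$ is a minimal complement in $G$ if it is a minimal left complement or a minimal right complement to some nonempty subset of $G$. *)

theory Defs
  imports "HOL-Algebra.Coset"
begin

definition left_complement :: "('a, 'b) monoid_scheme \<Rightarrow> 'a set \<Rightarrow> 'a set \<Rightarrow> bool" where
  "left_complement G A B \<longleftrightarrow>
     A \<subseteq> carrier G \<and> A \<noteq> {} \<and> B \<subseteq> carrier G \<and> B \<noteq> {} \<and> A <#>\<^bsub>G\<^esub> B = carrier G"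

definition right_complement :: "('a, 'b) monoid_scheme \<Rightarrow> 'a set \<Rightarrow> 'a set \<Rightarrow> bool" where
  "right_complement G A B \<longleftrightarrow>
     A \<subseteq> carrier G \<and> A \<noteq> {} \<and> B \<subseteq> carrier G \<and> B \<noteq> {} \<and> B <#>\<^bsub>G\<^esub> A = carrier G"

definition minimal_left_complement :: "('a, 'b) monoid_scheme \<Rightarrow> 'a set \<Rightarrow> 'a set \<Rightarrow> bool" where
  "minimal_left_complement G A B \<longleftrightarrow>
     left_complement G A B \<and> (\<forall>A'. A' \<subset> A \<longrightarrow> \<not> left_complement G A' B)"

definition minimal_right_complement :: "('a, 'b) monoid_scheme \<Rightarrow> 'a set \<Rightarrow> 'a set \<Rightarrow> bool" where
  "minimal_right_complement G A B \<longleftrightarrow>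
     right_complement G A B \<and> (\<forall>A'. A' \<subset> A \<longrightarrow> \<not> right_complement G A' B)"

definition is_minimal_complement :: "('a, 'b) monoid_scheme \<Rightarrow> 'a set \<Rightarrow> bool" where
  "is_minimal_complement G A \<longleftrightarrow>
     (\<exists>B. B \<subseteq> carrier G \<and> B \<noteq> {} \<and>
        (minimal_left_complement G A B \<or> minimal_right_complement G A B))"

definition union_of_rcosets :: "('a, 'b) monoid_scheme \<Rightarrow> 'a set \<Rightarrow> 'a set \<Rightarrow> bool" where
  "union_of_rcosets G K S \<longleftrightarrow> (\<exists>\<R>. \<R> \<subseteq> rcosets\<^bsub>G\<^esub> K \<and> S = \<Union>\<R>)"

definition union_of_finitely_many_rcosets :: "('a, 'b) monoid_scheme \<Rightarrow> 'a set \<Rightarrow> 'a set \<Rightarrow> bool" where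
  "union_of_finitely_many_rcosets G K S \<longleftrightarrow>
     (\<exists>\<R>. \<R> \<subseteq> rcosets\<^bsub>G\<^esub> K \<and> finite \<R> \<and> S = \<Union>\<R>)"

definition rcosets_within :: "('a, 'b) monoid_scheme \<Rightarrow> 'a set \<Rightarrow> 'a set \<Rightarrow> 'a set set" where
  "rcosets_within G K S = {R \<in> rcosets\<^bsub>G\<^esub> K. R \<subseteq> S}"

end

theory Submission
  imports Defs
begin

text \<open>
  Let \<open>A = (C - E) \<union> F\<close>, \<open>D = H - C\<close>, and let \<open>n\<close> be the index of \<open>H\<close> and \<open>d\<close> the number of
  cosets of \<open>K\<close> in \<open>D\<close>. If \<open>A\<close> is a minimal left complement to \<open>B\<close>, then every \<open>a\<close> in \<open>C - E\<close>
  serves a point \<open>w a\<close> that no other element of \<open>A\<close> covers, while \<open>B\<close> meets every right coset of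
  \<open>H\<close> in two distinct elements \<open>b\<close>, \<open>b'\<close> (otherwise \<open>A = H\<close>). A point \<open>w a\<close> in that coset lies
  in \<open>D b \<union> D b'\<close> or, by uniqueness, in \<open>E b \<union> E b'\<close>. So all but at most \<open>2 n |E|\<close> of the \<open>w a\<close> lie
  in one of at most \<open>2 n d\<close> cosets of \<open>K\<close>, and each of these cosets accounts for either at most
  \<open>2 |E|\<close> elements \<open>a\<close> or for elements of a single coset of \<open>K\<close>. Since \<open>C\<close> contains \<open>2 n d + 1\<close>
  cosets of \<open>K\<close>, each with at least \<open>(2 n + 1) |E| + 1\<close> elements, counting gives a contradiction.
  Right complements are turned into left ones by taking inverses, as \<open>K\<close> is normal in \<open>H\<close>.
\<close>

context group
begin

section \<open>Right cosets and unions of them\<close>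

lemma rcoset_eqI:
  assumes "subgroup K G" "Q \<in> rcosets K" "x \<in> Q"
  shows "Q = K #> x"
proof -
  obtain g where "g \<in> carrier G" "Q = K #> g"
    using assms(2) unfolding RCOSETS_def by auto
  then show ?thesis
    using repr_independence[of x K g] assms by auto
qed

lemma union_of_rcosets_saturated:
  assumes "subgroup K G" "union_of_rcosets G K S" "x \<in> S"
  shows "K #> x \<subseteq> S"
proof -
  obtain \<R> where "\<R> \<subseteq> rcosets K" "S = \<Union>\<R>"
    using assms(2) unfolding union_of_rcosets_def by auto
  then show ?thesis
    using rcoset_eqI[OF assms(1)] assms(3) by blast
qed

text \<open>A coset inside \<open>S\<close> shares a point with some member of the finite family,
  and cosets that meet coincide, so it belongs to that family.\<close>

lemma finite_rcosets_within:
  assumes "subgroup K G" "union_of_finitely_many_rcosets G K S"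
  shows "finite (rcosets_within G K S)"
proof -
  obtain \<R> where R: "\<R> \<subseteq> rcosets K" "finite \<R>" "S = \<Union>\<R>"
    using assms(2) unfolding union_of_finitely_many_rcosets_def by auto
  have "rcosets_within G K S \<subseteq> \<R>"
  proof
    fix Q assume "Q \<in> rcosets_within G K S"
    then have Q: "Q \<in> rcosets K" "Q \<subseteq> S"
      by (auto simp: rcosets_within_def)
    then obtain g where "g \<in> carrier G" "Q = K #> g"
      unfolding RCOSETS_def by auto
    then have g: "g \<in> Q"
      using rcos_self assms(1) by auto
    then obtain R' where "R' \<in> \<R>" "g \<in> R'" using Q R by auto
    then show "Q \<in> \<R>"
      using rcoset_eqI[OF assms(1)] Q(1) g R(1) by blast
  qed
  then show ?thesis using R(2) finite_subset by auto
qed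

lemma card_r_coset_le:
  assumes "finite E"
  shows "card (E #> b) \<le> card E" "finite (E #> b)"
proof -
  have eq: "E #> b = (\<lambda>e. e \<otimes> b) ` E"
    by (auto simp: r_coset_def)
  show "card (E #> b) \<le> card E" "finite (E #> b)"
    unfolding eq using assms by (auto intro: card_image_le)
qed

lemma card_r_coset:
  assumes "K \<subseteq> carrier G" "g \<in> carrier G"
  shows "card (K #> g) = card K" "finite (K #> g) \<longleftrightarrow> finite K"
proof -
  have eq: "K #> g = (\<lambda>e. e \<otimes> g) ` K"
    by (auto simp: r_coset_def)
  have inj: "inj_on (\<lambda>e. e \<otimes> g) K"
    using assms by (auto intro!: inj_onI simp: subset_iff)
  show "card (K #> g) = card K" "finite (K #> g) \<longleftrightarrow> finite K"
    unfolding eq using inj by (auto simp: card_image finite_image_iff)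
qed

lemma mem_r_coset_iff:
  assumes "S \<subseteq> carrier G" "g \<in> carrier G" "b \<in> carrier G"
  shows "g \<in> S #> b \<longleftrightarrow> g \<otimes> inv b \<in> S"
proof
  assume "g \<in> S #> b"
  then obtain s where s: "s \<in> S" "g = s \<otimes> b"
    by (auto simp: r_coset_def)
  then have "s \<in> carrier G" using assms by auto
  then have "g \<otimes> inv b = s" using s assms by (simp add: m_assoc)
  then show "g \<otimes> inv b \<in> S" using s by simp
next
  assume "g \<otimes> inv b \<in> S"
  moreover have "g = g \<otimes> inv b \<otimes> b" using assms by (simp add: m_assoc)
  ultimately show "g \<in> S #> b" unfolding r_coset_def by blast
qed

section \<open>Uniquely covered points, and pairs of elements of \<open>B\<close> in one
  coset\<close>

text \<open>Removing \<open>a\<close> must leave some \<open>g\<close> uncovered, and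
  \<open>A <#> B\<close> still reaches \<open>g\<close>, hence only through \<open>a\<close>.
  Quotients \<open>g \<otimes> inv b\<close> are used because they are what is later located in
  \<open>C\<close>, \<open>E\<close> or \<open>H - C\<close>.\<close>

lemma minimal_left_complement_unique_cover:
  assumes "minimal_left_complement G A B" "a \<in> A"
  shows "\<exists>g. g \<in> carrier G \<and> (\<exists>b\<in>B. g = a \<otimes> b)
           \<and> (\<forall>b\<in>B. g \<otimes> inv b \<in> A \<longrightarrow> g \<otimes> inv b = a)"
proof -
  have AB: "A \<subseteq> carrier G" "B \<subseteq> carrier G" "B \<noteq> {}" "A <#> B = carrier G"
    using assms by (auto simp: minimal_left_complement_def left_complement_def)
  have "A - {a} \<subset> A" using assms by auto
  then have nl: "\<not> left_complement G (A - {a}) B"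
    using assms by (auto simp: minimal_left_complement_def)
  have sub: "(A - {a}) <#> B \<subseteq> carrier G"
    using AB by (auto simp: set_mult_def)
  have "(A - {a}) <#> B \<noteq> carrier G"
  proof
    assume eq: "(A - {a}) <#> B = carrier G"
    \<comment> \<open>\<open>left_complement\<close> also requires nonempty sets, so the case
      \<open>A = {a}\<close> is excluded here: an empty set has an empty product, while the carrier
      contains the identity.\<close>
    then have "A - {a} \<noteq> {}" using one_closed by (auto simp: set_mult_def)
    then show False using nl eq AB by (auto simp: left_complement_def)
  qed
  then obtain g where g: "g \<in> carrier G" "g \<notin> (A - {a}) <#> B"
    using sub by auto
  have other: "\<forall>b\<in>B. g \<otimes> inv b \<in> A \<longrightarrow> g \<otimes> inv b = a"
  proof (intro ballI impI, rule ccontr)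
    fix b assume b: "b \<in> B" "g \<otimes> inv b \<in> A" "g \<otimes> inv b \<noteq> a"
    have "g = g \<otimes> inv b \<otimes> b" using b g AB by (auto simp: m_assoc)
    then have "g \<in> (A - {a}) <#> B" using b unfolding set_mult_def by blast
    then show False using g by simp
  qed
  have "g \<in> A <#> B" using g AB by simp
  then obtain a' b where ab: "a' \<in> A" "b \<in> B" "g = a' \<otimes> b"
    by (auto simp: set_mult_def)
  then have "a' = a" using g by (auto simp: set_mult_def)
  then show ?thesis using g ab other by auto
qed

text \<open>As \<open>A\<close> lies in \<open>H\<close>, a point of \<open>R\<close> can only be
  covered with some \<open>b\<close> in \<open>R\<close>. If \<open>b\<close> were the only one,
  then \<open>A #> b = H #> b\<close>, and cancelling gives \<open>A = H\<close>.\<close>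

lemma left_complement_two_in_rcoset:
  assumes H: "subgroup H G" and A: "A \<subset> H" and AB: "left_complement G A B"
    and R: "R \<in> rcosets H"
  shows "\<exists>b b'. b \<in> B \<and> b' \<in> B \<and> b \<in> R \<and> b' \<in> R \<and> b \<noteq> b'"
proof (rule ccontr)
  assume no: "\<not> ?thesis"
  have Hc: "H \<subseteq> carrier G" using H by (rule subgroup.subset)
  have AB': "B \<subseteq> carrier G" "A <#> B = carrier G"
    using AB by (auto simp: left_complement_def)
  obtain r where r: "r \<in> carrier G" "R = H #> r"
    using R unfolding RCOSETS_def by auto
  obtain x where x: "x \<in> H" "x \<notin> A" using A by auto
  have "r \<in> A <#> B" using r AB' by simp
  then obtain a b where ab: "a \<in> A" "b \<in> B" "r = a \<otimes> b"
    by (auto simp: set_mult_def)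
  have abc: "a \<in> carrier G" "a \<in> H" "b \<in> carrier G" "x \<in> carrier G"
    using ab A AB' Hc x by auto
  have "r \<in> H #> b" using ab abc by (auto simp: r_coset_def)
  then have Rb: "R = H #> b"
    using r repr_independence[OF _ abc(3) H] by simp
  have "x \<otimes> b \<in> A <#> B" using abc AB' by simp
  then obtain a' b' where ab': "a' \<in> A" "b' \<in> B" "x \<otimes> b = a' \<otimes> b'"
    by (auto simp: set_mult_def)
  have abc': "a' \<in> carrier G" "a' \<in> H" "b' \<in> carrier G"
    using ab' A AB' Hc by auto
  have "b' = inv a' \<otimes> (a' \<otimes> b')" using abc' by (simp add: m_assoc[symmetric])
  also have "\<dots> = (inv a' \<otimes> x) \<otimes> b"
    using ab' abc' abc by (simp add: m_assoc)
  finally have "b' \<in> R"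
    unfolding Rb r_coset_def using abc' x H
    by (auto intro!: subgroup.m_closed subgroup.m_inv_closed)
  moreover have "b \<in> R" unfolding Rb using rcos_self H abc by auto
  ultimately have "b' = b" using no ab ab' by blast
  then have "a' = x" using ab' abc abc' by simp
  then show False using ab' x by simp
qed

section \<open>The counting argument for left complements\<close>

text \<open>The properness of \<open>F \<subset> H - C\<close> makes \<open>A\<close> a proper
  subset of \<open>H\<close>, and \<open>cardK\<close> lets every coset of \<open>K\<close> supply
  enough elements for the count. Infinite sets have \<open>card\<close> 0, hence the finiteness
  premises in \<open>cardC\<close> and \<open>cardK\<close>.\<close>

lemma not_minimal_left_complement:
  assumes H: "subgroup H G" and fin: "finite (rcosets H)"
    and K: "subgroup K G" and KH: "K \<subseteq> H" and CH: "C \<subseteq> H"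
    and CK: "union_of_rcosets G K C"
    and finD: "finite (rcosets_within G K (H - C))"
    and cardC: "finite (rcosets_within G K C) \<longrightarrow>
           card (rcosets_within G K C) > 2 * card (rcosets H) * card (rcosets_within G K (H - C))"
    and E: "finite E" "E \<subseteq> C" and F: "F \<subset> H - C"
    and cardK: "finite K \<longrightarrow> card K > (2 * card (rcosets H) + 1) * card E"
  shows "\<not> minimal_left_complement G ((C - E) \<union> F) B"
proof
  let ?n = "card (rcosets H)" and ?D = "H - C"
  let ?d = "card (rcosets_within G K (H - C))"
  define A where "A = (C - E) \<union> F"
  \<comment> \<open>The number of elements sampled in each coset. With n, d for \<open>?n\<close>,
    \<open>?d\<close>, it gives (2*n*d + 1)*t - |E| = 2*n*d*t + 2*n*|E| + 1, one more than the upper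
    bound reached at the end.\<close>
  define t where "t = (2 * ?n + 1) * card E + 1"
  assume min: "minimal_left_complement G ((C - E) \<union> F) B"
  then have min: "minimal_left_complement G A B" by (simp add: A_def)
  then have lc: "left_complement G A B" by (simp add: minimal_left_complement_def)
  then have Bc: "B \<subseteq> carrier G" by (simp add: left_complement_def)
  have Hc: "H \<subseteq> carrier G" using H by (rule subgroup.subset)
  have Kc: "K \<subseteq> carrier G" using K by (rule subgroup.subset)
  have AH: "A \<subset> H" using F CH unfolding A_def by auto
  have Csat: "K #> x \<subseteq> C" if "x \<in> C" for x
    using union_of_rcosets_saturated[OF K CK that] .
  have Dsat: "K #> x \<subseteq> ?D" if x: "x \<in> ?D" for x
  proof
    fix y assume y: "y \<in> K #> x"
    have xc: "x \<in> carrier G" using x Hc by auto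
    have yH: "y \<in> H" using y x KH H
      by (auto simp: r_coset_def intro: subgroup.m_closed)
    have "K #> x = K #> y" using y xc K by (rule repr_independence)
    then have "x \<in> K #> y" using rcos_self[OF xc K] by simp
    then show "y \<in> ?D" using Csat yH x by auto
  qed

  obtain w where w: "\<And>a. a \<in> A \<Longrightarrow> w a \<in> carrier G"
      "\<And>a. a \<in> A \<Longrightarrow> \<exists>b\<in>B. w a = a \<otimes> b"
      "\<And>a b. a \<in> A \<Longrightarrow> b \<in> B \<Longrightarrow> w a \<otimes> inv b \<in> A \<Longrightarrow> w a \<otimes> inv b = a"
    using minimal_left_complement_unique_cover[OF min] by metis
  \<comment> \<open>A common value of \<open>w\<close> at \<open>a\<close> and \<open>a'\<close> is
    covered by \<open>a\<close>, and by nothing except \<open>a'\<close>.\<close>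
  have w_inj: "inj_on w A"
  proof (rule inj_onI)
    fix a a' assume a: "a \<in> A" "a' \<in> A" "w a = w a'"
    obtain b where b: "b \<in> B" "w a = a \<otimes> b" using w(2)[OF a(1)] by auto
    have "a \<in> carrier G" "b \<in> carrier G" using a b AH Hc Bc by auto
    then have "w a \<otimes> inv b = a" using b by (simp add: m_assoc)
    then show "a = a'" using w(3)[OF a(2) b(1)] a by simp
  qed
  \<comment> \<open>If neither quotient lay in \<open>E\<close>, both would lie in
    \<open>C - E\<close>, hence in \<open>A\<close>, and uniqueness would make both equal to
    \<open>a\<close>, forcing \<open>b = b'\<close>.\<close>
  have w_E: "w a \<in> (E #> b) \<union> (E #> b')"
    if "a \<in> A" "b \<in> B" "b' \<in> B" "b \<noteq> b'" "w a \<otimes> inv b \<in> C" "w a \<otimes> inv b' \<in> C" for a b b'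
  proof (rule ccontr)
    assume no: "\<not> ?thesis"
    have c: "w a \<in> carrier G" "b \<in> carrier G" "b' \<in> carrier G" "E \<subseteq> carrier G"
      using that w Bc E CH Hc by auto
    have "w a \<otimes> inv b \<in> A" "w a \<otimes> inv b' \<in> A"
      using no that c mem_r_coset_iff unfolding A_def by auto
    then have "w a \<otimes> inv b = w a \<otimes> inv b'" using w(3)[OF that(1,2)] w(3)[OF that(1,3)] by simp
    then have "inv b = inv b'" using c by simp
    then show False using c that inv_inv by metis
  qed

  \<comment> \<open>Locating the points \<open>w a\<close>\<close>
  obtain u v where uv: "\<And>R. R \<in> rcosets H \<Longrightarrow> u R \<in> B \<and> v R \<in> B \<and> u R \<in> R \<and> v R \<in> R \<and> u R \<noteq> v R"
    using left_complement_two_in_rcoset[OF H AH lc] by metis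
  \<comment> \<open>\<open>P\<close> collects the translates of the cosets of \<open>K\<close> in
    \<open>?D\<close>, two per coset of \<open>H\<close> and coset in \<open>?D\<close>.
    \<open>X\<close> collects the exceptional points allowed by \<open>w_E\<close>.\<close>
  define P where "P = (\<Union>R\<in>rcosets H. (\<lambda>Q. Q #> u R) ` rcosets_within G K ?D
                                  \<union> (\<lambda>Q. Q #> v R) ` rcosets_within G K ?D)"
  define X where "X = (\<Union>R\<in>rcosets H. (E #> u R) \<union> (E #> v R))"
  have finP: "finite P" unfolding P_def using fin finD by auto
  have cardP: "card P \<le> ?n * (2 * ?d)"
  proof -
    have "card P \<le> (\<Sum>R\<in>rcosets H. card ((\<lambda>Q. Q #> u R) ` rcosets_within G K ?D
                                  \<union> (\<lambda>Q. Q #> v R) ` rcosets_within G K ?D))"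
      unfolding P_def by (rule card_UN_le[OF fin])
    also have "\<dots> \<le> (\<Sum>R\<in>rcosets H. 2 * ?d)"
    proof (rule sum_mono)
      fix R
      show "card ((\<lambda>Q. Q #> u R) ` rcosets_within G K ?D
              \<union> (\<lambda>Q. Q #> v R) ` rcosets_within G K ?D) \<le> 2 * ?d"
        using card_Un_le[of "(\<lambda>Q. Q #> u R) ` rcosets_within G K ?D" "(\<lambda>Q. Q #> v R) ` rcosets_within G K ?D"]
          card_image_le[OF finD, of "\<lambda>Q. Q #> u R"] card_image_le[OF finD, of "\<lambda>Q. Q #> v R"]
        by linarith
    qed
    finally show ?thesis by simp
  qed
  have card_EE: "card ((E #> b) \<union> (E #> b')) \<le> 2 * card E" for b b'
    using card_Un_le[of "E #> b" "E #> b'"] card_r_coset_le(1)[OF E(1), of b]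
      card_r_coset_le(1)[OF E(1), of b'] by linarith
  have finX: "finite X" unfolding X_def using fin E(1) by (auto intro: card_r_coset_le)
  have cardX: "card X \<le> ?n * (2 * card E)"
  proof -
    have "card X \<le> (\<Sum>R\<in>rcosets H. card ((E #> u R) \<union> (E #> v R)))"
      unfolding X_def by (rule card_UN_le[OF fin])
    also have "\<dots> \<le> (\<Sum>R\<in>rcosets H. 2 * card E)"
      by (rule sum_mono) (rule card_EE)
    finally show ?thesis by simp
  qed

  \<comment> \<open>For \<open>R\<close> the coset of \<open>H\<close> through \<open>w a\<close>,
    the quotients by \<open>u R\<close> and \<open>v R\<close> both lie in \<open>H\<close>. If one
    is in \<open>?D\<close>, then \<open>w a\<close> is in a member of \<open>P\<close>; if both are
    in \<open>C\<close>, \<open>w_E\<close> puts it in \<open>X\<close>.\<close>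
  have w_PX: "w a \<in> \<Union>P \<union> X" if a: "a \<in> A" for a
  proof -
    define g where "g = w a"
    have g: "g \<in> carrier G" using w a by (simp add: g_def)
    define R where "R = H #> g"
    have R: "R \<in> rcosets H" unfolding R_def RCOSETS_def using g by auto
    have in_H: "g \<otimes> inv b \<in> H" if "b \<in> R" "b \<in> carrier G" for b
    proof -
      have "H #> g = H #> b" using repr_independence[OF _ g H] that R_def by simp
      then have "g \<in> H #> b" using rcos_self[OF g H] by simp
      then show ?thesis using mem_r_coset_iff Hc g that by simp
    qed
    have in_P: "g \<in> \<Union>P" if b: "b = u R \<or> b = v R" and D: "g \<otimes> inv b \<in> ?D" for b
    proof -
      have bc: "b \<in> carrier G" using uv[OF R] b Bc by auto
      let ?Q = "K #> (g \<otimes> inv b)"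
      have "?Q \<in> rcosets_within G K ?D"
        unfolding rcosets_within_def RCOSETS_def using Dsat[OF D] g bc by auto
      then have "?Q #> b \<in> P" unfolding P_def using R b by auto
      moreover have "g \<in> ?Q #> b"
      proof -
        have "g = (g \<otimes> inv b) \<otimes> b" using g bc by (simp add: m_assoc)
        moreover have "g \<otimes> inv b \<in> ?Q" using rcos_self[OF _ K] g bc by simp
        ultimately show ?thesis unfolding r_coset_def by blast
      qed
      ultimately show ?thesis by auto
    qed
    have "g \<otimes> inv (u R) \<in> H" "g \<otimes> inv (v R) \<in> H"
      using in_H uv[OF R] Bc by auto
    then consider "g \<otimes> inv (u R) \<in> ?D" | "g \<otimes> inv (v R) \<in> ?D"
      | "g \<otimes> inv (u R) \<in> C" "g \<otimes> inv (v R) \<in> C" by blast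
    then show ?thesis
    proof cases
      case 3
      then have "g \<in> (E #> u R) \<union> (E #> v R)"
        using w_E[OF a] uv[OF R] g_def by auto
      then show ?thesis unfolding X_def using R g_def by auto
    qed (use in_P g_def in auto)
  qed

  \<comment> \<open>A finite sample of \<open>C\<close>\<close>
  \<comment> \<open>One coset more than the bound on \<open>card P\<close>. Both the number of
    cosets in \<open>C\<close> and the size of \<open>K\<close> may be infinite, so finitely many
    cosets are taken, and then \<open>t\<close> elements of each.\<close>
  have "\<exists>\<Y>. \<Y> \<subseteq> rcosets_within G K C \<and> finite \<Y> \<and> card \<Y> = 2 * ?n * ?d + 1"
  proof (cases "finite (rcosets_within G K C)")
    case True
    then have "2 * ?n * ?d + 1 \<le> card (rcosets_within G K C)" using cardC by auto
    then show ?thesis using True by (meson obtain_subset_with_card_n)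
  next
    case False
    then show ?thesis using infinite_arbitrarily_large by metis
  qed
  then obtain \<Y> where Y: "\<Y> \<subseteq> rcosets_within G K C" "finite \<Y>" "card \<Y> = 2 * ?n * ?d + 1"
    by auto
  have "\<exists>S. S \<subseteq> Q \<and> finite S \<and> card S = t" if Q: "Q \<in> rcosets K" for Q
  proof -
    obtain g where g: "g \<in> carrier G" "Q = K #> g"
      using Q unfolding RCOSETS_def by auto
    show ?thesis
    proof (cases "finite Q")
      case True
      then have "t \<le> card Q" using g card_r_coset[OF Kc g(1)] cardK by (auto simp: t_def)
      then show ?thesis using True by (meson finite_subset obtain_subset_with_card_n)
    next
      case False
      then show ?thesis using infinite_arbitrarily_large by metis
    qed
  qed
  then obtain \<tau> where tau: "\<And>Q. Q \<in> rcosets K \<Longrightarrow> \<tau> Q \<subseteq> Q \<and> finite (\<tau> Q) \<and> card (\<tau> Q) = t"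
    by metis
  define T where "T = (\<Union>Q\<in>\<Y>. \<tau> Q)"
  have YK: "Q \<in> rcosets K" "Q \<subseteq> C" if "Q \<in> \<Y>" for Q
    using that Y by (auto simp: rcosets_within_def)
  have finT: "finite T" unfolding T_def using Y YK tau by auto
  have TC: "T \<subseteq> C" unfolding T_def using YK tau by blast
  have tau_coset: "Q = K #> y" if Q: "Q \<in> \<Y>" and y: "y \<in> \<tau> Q" for Q y
  proof (rule rcoset_eqI[OF K YK(1)[OF Q]])
    show "y \<in> Q" using tau[OF YK(1)[OF Q]] y by auto
  qed
  have cardT: "card T = (2 * ?n * ?d + 1) * t"
  proof -
    have "card T = (\<Sum>Q\<in>\<Y>. card (\<tau> Q))"
      unfolding T_def
    proof (rule card_UN_disjoint)
      show "\<forall>Q\<in>\<Y>. \<forall>Q'\<in>\<Y>. Q \<noteq> Q' \<longrightarrow> \<tau> Q \<inter> \<tau> Q' = {}"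
      proof (intro ballI impI)
        fix Q Q' assume Q: "Q \<in> \<Y>" "Q' \<in> \<Y>" "Q \<noteq> Q'"
        show "\<tau> Q \<inter> \<tau> Q' = {}"
          using tau_coset[OF Q(1)] tau_coset[OF Q(2)] Q(3) by auto
      qed
    qed (use Y YK tau in auto)
    also have "\<dots> = (\<Sum>Q\<in>\<Y>. t)" using YK tau by simp
    finally show ?thesis using Y by simp
  qed
  \<comment> \<open>Sampled elements of \<open>K #> x\<close> can only come from
    \<open>\<tau> (K #> x)\<close>. As \<open>\<tau>\<close> is given on all cosets of
    \<open>K\<close>, this also covers cosets outside \<open>\<Y>\<close>, where the intersection is
    empty.\<close>
  have T_coset: "card (T \<inter> (K #> x)) \<le> t" if x: "x \<in> C" for x
  proof -
    have "T \<inter> (K #> x) \<subseteq> \<tau> (K #> x)"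
    proof
      fix y assume y: "y \<in> T \<inter> (K #> x)"
      then obtain Q where Q: "Q \<in> \<Y>" "y \<in> \<tau> Q" unfolding T_def by auto
      then have "Q = K #> y" by (rule tau_coset)
      moreover have "x \<in> carrier G" using x CH Hc by auto
      then have "K #> x = K #> y"
        using repr_independence[OF _ _ K] y by simp
      ultimately show "y \<in> \<tau> (K #> x)" using Q by simp
    qed
    moreover have "K #> x \<in> rcosets K" unfolding RCOSETS_def using x CH Hc by auto
    ultimately show ?thesis
      using tau[of "K #> x"] card_mono[of "\<tau> (K #> x)" "T \<inter> (K #> x)"] by simp
  qed

  \<comment> \<open>If \<open>Q b\<inverse>\<close> and \<open>Q b'\<inverse>\<close> both lie in \<open>C\<close> for distinct \<open>b\<close>, \<open>b'\<close> in \<open>B\<close>, uniqueness of the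
    cover forces \<open>w a\<close> into \<open>E b \<union> E b'\<close>; otherwise all these \<open>a\<close> lie in one coset of \<open>K\<close>.\<close>
  have block: "card {a \<in> T - E. w a \<in> Q} \<le> t" if Q: "Q \<in> P" for Q
  proof -
    have TA: "T - E \<subseteq> A" using TC unfolding A_def by auto
    obtain x b0 where "Q = (K #> x) #> b0" "x \<in> carrier G" "b0 \<in> carrier G"
    proof -
      obtain R Q0 where R: "R \<in> rcosets H" and Q0: "Q0 \<in> rcosets_within G K ?D"
        and "Q = Q0 #> u R \<or> Q = Q0 #> v R" using Q unfolding P_def by blast
      moreover obtain x where "x \<in> carrier G" "Q0 = K #> x"
        using Q0 unfolding rcosets_within_def RCOSETS_def by auto
      ultimately show ?thesis using that uv[OF R] Bc by blast
    qed
    then have Qeq: "Q = K #> (x \<otimes> b0)" "x \<otimes> b0 \<in> carrier G"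
      using coset_mult_assoc[OF Kc] by auto
    then have Qcoset: "Q \<in> rcosets K" unfolding RCOSETS_def by auto
    have Qc: "Q \<subseteq> carrier G"
      using Qeq r_coset_subset_G[OF Kc] by simp
    \<comment> \<open>From \<open>g' = k \<otimes> g\<close> the quotients by \<open>b\<close>
      differ by the same left factor \<open>k\<close>. As \<open>C\<close> is saturated under
      \<open>K\<close>, whether the quotient by \<open>b\<close> lies in \<open>C\<close> depends on
      \<open>Q\<close> alone.\<close>
    have transfer: "g' \<otimes> inv b \<in> K #> (g \<otimes> inv b)"
      if "g \<in> Q" "g' \<in> Q" "b \<in> carrier G" for g g' b
    proof -
      have gc: "g \<in> carrier G" "g' \<in> carrier G" using that Qc by auto
      have "g' \<in> K #> g" using rcoset_eqI[OF K Qcoset that(1)] that(2) by simp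
      then obtain k where k: "k \<in> K" "g' = k \<otimes> g" by (auto simp: r_coset_def)
      then have "g' \<otimes> inv b = k \<otimes> (g \<otimes> inv b)"
        using gc that Kc by (simp add: m_assoc subset_iff)
      then show ?thesis using k unfolding r_coset_def by blast
    qed
    show ?thesis
    proof (cases "\<exists>g\<in>Q. \<exists>b\<in>B. \<exists>b'\<in>B. b \<noteq> b' \<and> g \<otimes> inv b \<in> C \<and> g \<otimes> inv b' \<in> C")
      case True
      then obtain g b b' where g: "g \<in> Q" "b \<in> B" "b' \<in> B" "b \<noteq> b'"
        "g \<otimes> inv b \<in> C" "g \<otimes> inv b' \<in> C" by auto
      have "w ` {a \<in> T - E. w a \<in> Q} \<subseteq> (E #> b) \<union> (E #> b')"
      proof clarify
        fix a assume a: "a \<in> T" "a \<notin> E" "w a \<in> Q" "w a \<notin> E #> b'"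
        have "w a \<otimes> inv b \<in> C" "w a \<otimes> inv b' \<in> C"
          using transfer[OF g(1) a(3)] Csat g Bc by blast+
        then show "w a \<in> E #> b" using w_E[of a b b'] g a TA by blast
      qed
      then have "card (w ` {a \<in> T - E. w a \<in> Q}) \<le> 2 * card E"
        using card_EE[of b b'] card_mono[of "(E #> b) \<union> (E #> b')"] card_r_coset_le(2)[OF E(1)]
        by (meson finite_Un le_trans)
      moreover have "card (w ` {a \<in> T - E. w a \<in> Q}) = card {a \<in> T - E. w a \<in> Q}"
        by (rule card_image) (rule inj_on_subset[OF w_inj], use TA in auto)
      \<comment> \<open>Positivity of \<open>?n\<close> gives 2 \<le> 2 * \<open>?n\<close> + 1, so
        the bound 2*|E| stays below \<open>t\<close>.\<close>
      moreover have "?n \<ge> 1"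
      proof -
        have "rcosets H \<noteq> {}" unfolding RCOSETS_def using one_closed by blast
        then show ?thesis using fin by (simp add: Suc_le_eq card_gt_0_iff)
      qed
      then have "2 * card E \<le> (2 * ?n + 1) * card E" by (intro mult_le_mono1) linarith
      then have "2 * card E \<le> t" unfolding t_def by linarith
      ultimately show ?thesis by simp
    next
      case False
      note single = this
      show ?thesis
      proof (cases "{a \<in> T - E. w a \<in> Q} = {}")
        case False
        have preimage: "\<exists>b\<in>B. w a \<otimes> inv b = a" if a: "a \<in> T - E" for a
        proof -
          have aA: "a \<in> A" using a TA by auto
          obtain b where b: "b \<in> B" "w a = a \<otimes> b" using w(2)[OF aA] by auto
          have "a \<in> carrier G" "b \<in> carrier G" using aA b AH Hc Bc by auto
          then have "w a \<otimes> inv b = a" using b by (simp add: m_assoc)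
          then show ?thesis using b by auto
        qed
        obtain a where a: "a \<in> T - E" "w a \<in> Q" using False by auto
        then obtain b where b: "b \<in> B" "w a \<otimes> inv b = a" using preimage by blast
        \<comment> \<open>The \<open>b\<close> that serves \<open>a\<close> serves every other
          \<open>a'\<close> too: the quotient of \<open>w a'\<close> by \<open>b\<close> lies in
          \<open>C\<close> by \<open>transfer\<close>, so \<open>single\<close> identifies
          \<open>b\<close> with the \<open>b'\<close> of \<open>a'\<close>. Then \<open>a'\<close>
          is that quotient, an element of \<open>K #> a\<close>.\<close>
        have "{a \<in> T - E. w a \<in> Q} \<subseteq> T \<inter> (K #> a)"
        proof
          fix a' assume "a' \<in> {a \<in> T - E. w a \<in> Q}"
          then have a': "a' \<in> T" "a' \<notin> E" "w a' \<in> Q" by auto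
          then obtain b' where b': "b' \<in> B" "w a' \<otimes> inv b' = a'" using preimage by blast
          have "w a' \<otimes> inv b \<in> K #> a" using transfer[OF a(2) a'(3), of b] b Bc by auto
          then have "w a' \<otimes> inv b \<in> C" using Csat a TC by blast
          moreover have "w a' \<otimes> inv b' \<in> C" using b'(2) a'(1) TC by auto
          ultimately have "b' = b" using single a'(3) b(1) b'(1) by auto
          then show "a' \<in> T \<inter> (K #> a)"
            using \<open>w a' \<otimes> inv b \<in> K #> a\<close> b' a' by simp
        qed
        then have "card {a \<in> T - E. w a \<in> Q} \<le> card (T \<inter> (K #> a))"
          using finT by (intro card_mono) auto
        then show ?thesis using T_coset[of a] a TC by auto
      next
        case True
        show ?thesis unfolding True by simp
      qed
    qed
  qed

  \<comment> \<open>Comparing the two bounds on \<open>card (T - E)\<close>\<close>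
  have TA: "T - E \<subseteq> A" using TC unfolding A_def by auto
  have "T - E \<subseteq> (\<Union>Q\<in>P. {a \<in> T - E. w a \<in> Q}) \<union> {a \<in> T - E. w a \<in> X}"
    using w_PX TA by blast
  then have "card (T - E) \<le> card ((\<Union>Q\<in>P. {a \<in> T - E. w a \<in> Q}) \<union> {a \<in> T - E. w a \<in> X})"
    using finT finP by (intro card_mono) auto
  also have "\<dots> \<le> card (\<Union>Q\<in>P. {a \<in> T - E. w a \<in> Q}) + card {a \<in> T - E. w a \<in> X}"
    by (rule card_Un_le)
  also have "card (\<Union>Q\<in>P. {a \<in> T - E. w a \<in> Q}) \<le> (\<Sum>Q\<in>P. card {a \<in> T - E. w a \<in> Q})"
    by (rule card_UN_le[OF finP])
  also have "\<dots> \<le> (\<Sum>Q\<in>P. t)" by (rule sum_mono) (rule block)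
  also have "\<dots> = card P * t" by simp
  also have "\<dots> \<le> ?n * (2 * ?d) * t" using cardP by (rule mult_le_mono1)
  also have "card {a \<in> T - E. w a \<in> X} \<le> card X"
  proof (rule card_inj_on_le[of w])
    show "inj_on w {a \<in> T - E. w a \<in> X}"
      by (rule inj_on_subset[OF w_inj]) (use TA in auto)
  qed (use finX in auto)
  also have "card X \<le> ?n * (2 * card E)" by (rule cardX)
  finally have "card (T - E) \<le> ?n * (2 * ?d) * t + ?n * (2 * card E)" by simp
  moreover have "card T - card E \<le> card (T - E)"
    using E(1) by (simp add: diff_card_le_card_Diff)
  moreover have "card T = 2 * ?n * ?d * t + (2 * ?n * card E + card E + 1)"
    unfolding cardT by (simp add: t_def algebra_simps)
  ultimately show False by (simp add: algebra_simps)
qed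

section \<open>Inversion: from right complements to left ones\<close>

lemma set_inv_set_inv:
  assumes "A \<subseteq> carrier G"
  shows "set_inv (set_inv A) = A"
  using assms by (force simp: SET_INV_def)

lemma set_inv_closed:
  assumes "A \<subseteq> carrier G"
  shows "set_inv A \<subseteq> carrier G"
  using assms by (auto simp: SET_INV_def)

lemma mem_set_inv_iff:
  assumes "A \<subseteq> carrier G" "x \<in> carrier G"
  shows "x \<in> set_inv A \<longleftrightarrow> inv x \<in> A"
  using assms by (force simp: SET_INV_def)

lemma set_inv_mono: "A \<subseteq> B \<Longrightarrow> set_inv A \<subseteq> set_inv B"
  by (auto simp: SET_INV_def)

lemma set_inv_set_mult:
  assumes "A \<subseteq> carrier G" "B \<subseteq> carrier G"
  shows "set_inv (B <#> A) = set_inv A <#> set_inv B"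
proof -
  have "inv (b \<otimes> a) = inv a \<otimes> inv b" if "a \<in> A" "b \<in> B" for a b
    using that assms by (intro inv_mult_group) auto
  then show ?thesis by (force simp: SET_INV_def set_mult_def)
qed

lemma set_inv_carrier: "set_inv (carrier G) = carrier G"
  using mem_set_inv_iff[of "carrier G"] set_inv_closed[of "carrier G"] by auto

text \<open>Inversion reverses products and maps the carrier onto itself, so it exchanges the two
  sides.\<close>

lemma left_complement_set_inv:
  assumes "A \<subseteq> carrier G" "B \<subseteq> carrier G"
  shows "left_complement G (set_inv A) (set_inv B) \<longleftrightarrow> right_complement G A B"
proof -
  have "set_inv A <#> set_inv B = carrier G \<longleftrightarrow> B <#> A = carrier G"
    using set_inv_set_mult[OF assms] set_inv_carrier set_inv_set_inv
      set_mult_closed[OF assms(2,1)] by metis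
  moreover have "set_inv S = {} \<longleftrightarrow> S = {}" for S
    by (auto simp: SET_INV_def)
  ultimately show ?thesis
    using assms set_inv_closed by (auto simp: left_complement_def right_complement_def)
qed

text \<open>A left complement to \<open>set_inv B\<close> properly inside \<open>set_inv A\<close>
  would invert to a right complement to \<open>B\<close> properly inside \<open>A\<close>.\<close>

lemma minimal_left_complement_set_inv:
  assumes "minimal_right_complement G A B"
  shows "minimal_left_complement G (set_inv A) (set_inv B)"
proof -
  have AB: "A \<subseteq> carrier G" "B \<subseteq> carrier G"
    using assms by (auto simp: minimal_right_complement_def right_complement_def)
  have "\<not> left_complement G A' (set_inv B)" if A': "A' \<subset> set_inv A" for A'
  proof
    assume lc: "left_complement G A' (set_inv B)"
    have A'c: "A' \<subseteq> carrier G" using A' set_inv_closed[OF AB(1)] by auto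
    have "set_inv A' \<subset> A"
      using A' set_inv_mono[of A' "set_inv A"] set_inv_set_inv[OF AB(1)] set_inv_set_inv[OF A'c]
      by auto
    moreover have "right_complement G (set_inv A') B"
      using left_complement_set_inv[OF set_inv_closed[OF A'c] AB(2)] set_inv_set_inv[OF A'c] lc
      by simp
    ultimately show False using assms by (auto simp: minimal_right_complement_def)
  qed
  then show ?thesis
    using assms left_complement_set_inv[OF AB]
    by (auto simp: minimal_left_complement_def minimal_right_complement_def)
qed

text \<open>The inverse of \<open>K #> h\<close> is a left coset of \<open>K\<close>, and normality
  in \<open>H\<close> turns it back into a right one. The fact for normal subgroups is applied in
  the group \<open>H\<close>, whose inverses and cosets agree with those of
  \<open>G\<close>.\<close>

lemma set_inv_rcoset:
  assumes "subgroup H G" "K \<lhd> G\<lparr>carrier := H\<rparr>" "h \<in> H"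
  shows "set_inv (K #> h) = K #> inv h"
proof -
  interpret N: normal K "G\<lparr>carrier := H\<rparr>" by fact
  have "inv\<^bsub>G\<lparr>carrier := H\<rparr>\<^esub> x = inv x" if "x \<in> H" for x
    using m_inv_consistent[OF assms(1) that] .
  moreover have "K #> h \<subseteq> H"
    using N.r_coset_subset_G[OF N.subset, of h] assms(3) by (simp add: r_coset_def)
  ultimately have "SET_INV (G\<lparr>carrier := H\<rparr>) (K #> h) = set_inv (K #> h)"
    unfolding SET_INV_def by (intro SUP_cong) auto
  then show ?thesis
    using N.rcos_inv[of h] assms(3) m_inv_consistent[OF assms(1,3)]
    by (simp add: r_coset_def)
qed

lemma rcosets_within_set_inv:
  assumes H: "subgroup H G" and K: "K \<lhd> G\<lparr>carrier := H\<rparr>" "subgroup K G" and S: "S \<subseteq> H"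
  shows "rcosets_within G K (set_inv S) = SET_INV G ` rcosets_within G K S"
proof -
  have Hc: "H \<subseteq> carrier G" using H by (rule subgroup.subset)
  \<comment> \<open>Stated for every subset of \<open>H\<close>, so that applying it to
    \<open>set_inv S\<close> yields the converse inclusion, inversion being an involution.\<close>
  have dir: "set_inv Q \<in> rcosets_within G K (set_inv S)"
    if Q: "Q \<in> rcosets_within G K S" and S: "S \<subseteq> H" for Q S
  proof -
    obtain g where g: "g \<in> carrier G" "Q = K #> g" "Q \<subseteq> S"
      using Q unfolding rcosets_within_def RCOSETS_def by auto
    then have "g \<in> H" using rcos_self[OF g(1) K(2)] S by auto
    then have "set_inv Q = K #> inv g" using set_inv_rcoset[OF H K(1)] g by simp
    then show ?thesis
      using g set_inv_mono[OF g(3)] unfolding rcosets_within_def RCOSETS_def by auto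
  qed
  have SH: "set_inv S \<subseteq> H"
    using S H by (auto simp: SET_INV_def intro: subgroup.m_inv_closed)
  show ?thesis
  proof (intro equalityI subsetI)
    fix Q assume Q: "Q \<in> rcosets_within G K (set_inv S)"
    then have "Q \<subseteq> carrier G" using SH Hc by (auto simp: rcosets_within_def)
    then have "Q = set_inv (set_inv Q)" using set_inv_set_inv by simp
    moreover have "set_inv Q \<in> rcosets_within G K S"
      using dir[OF Q SH] set_inv_set_inv[of S] S Hc by auto
    ultimately show "Q \<in> SET_INV G ` rcosets_within G K S" by blast
  qed (use dir S in auto)
qed

lemma union_of_rcosets_set_inv:
  assumes H: "subgroup H G" and K: "K \<lhd> G\<lparr>carrier := H\<rparr>" "subgroup K G" and S: "S \<subseteq> H"
    and "union_of_rcosets G K S"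
  shows "union_of_rcosets G K (set_inv S)"
proof -
  obtain \<R> where R: "\<R> \<subseteq> rcosets K" "S = \<Union>\<R>"
    using assms(5) unfolding union_of_rcosets_def by auto
  have "\<R> \<subseteq> rcosets_within G K S" using R by (auto simp: rcosets_within_def)
  then have "SET_INV G ` \<R> \<subseteq> rcosets_within G K (set_inv S)"
    using rcosets_within_set_inv[OF H K S] by auto
  moreover have "set_inv S = \<Union>(SET_INV G ` \<R>)" using R by (auto simp: SET_INV_def)
  ultimately show ?thesis unfolding union_of_rcosets_def rcosets_within_def by blast
qed

lemma set_inv_Diff:
  assumes "A \<subseteq> carrier G" "B \<subseteq> carrier G"
  shows "set_inv (A - B) = set_inv A - set_inv B"
proof -
  have "inj_on (m_inv G) (carrier G)" by (metis inj_onI inv_inv)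
  moreover have "set_inv S = m_inv G ` S" for S by (auto simp: SET_INV_def)
  ultimately show ?thesis using assms inj_on_image_set_diff[of "m_inv G" "carrier G" A B] by auto
qed

lemma card_set_inv:
  assumes "A \<subseteq> carrier G"
  shows "card (set_inv A) = card A" "finite (set_inv A) \<longleftrightarrow> finite A"
proof -
  have "inj_on (m_inv G) A" by (rule inj_onI) (metis assms inv_inv subsetD)
  moreover have "set_inv A = m_inv G ` A" by (auto simp: SET_INV_def)
  ultimately show "card (set_inv A) = card A" "finite (set_inv A) \<longleftrightarrow> finite A"
    by (simp_all add: card_image finite_image_iff)
qed

lemma set_inv_subgroup:
  assumes "subgroup H G"
  shows "set_inv H = H"
proof
  show sub: "set_inv H \<subseteq> H"
    using assms by (auto simp: SET_INV_def intro: subgroup.m_inv_closed)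
  show "H \<subseteq> set_inv H"
    using set_inv_mono[OF sub] set_inv_set_inv[OF subgroup.subset[OF assms]] by simp
qed

text \<open>All hypotheses survive inversion: it maps \<open>H - C\<close> onto
  \<open>H - set_inv C\<close>, permutes the cosets of \<open>K\<close> in \<open>H\<close> and
  preserves cardinalities. So the left-sided result applies to the set and to its inverse.\<close>

lemma not_is_minimal_complement:
  assumes H: "subgroup H G" and fin: "finite (rcosets H)"
    and K: "K \<lhd> G\<lparr>carrier := H\<rparr>" "subgroup K G" and KH: "K \<subseteq> H" and CH: "C \<subseteq> H"
    and CK: "union_of_rcosets G K C"
    and finD: "finite (rcosets_within G K (H - C))"
    and cardC: "finite (rcosets_within G K C) \<longrightarrow>
           card (rcosets_within G K C) > 2 * card (rcosets H) * card (rcosets_within G K (H - C))"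
    and E: "finite E" "E \<subseteq> C" and F: "F \<subset> H - C"
    and cardK: "finite K \<longrightarrow> card K > (2 * card (rcosets H) + 1) * card E"
  shows "\<not> is_minimal_complement G ((C - E) \<union> F)"
proof -
  have Hc: "H \<subseteq> carrier G" using H by (rule subgroup.subset)
  have subs: "C \<subseteq> carrier G" "E \<subseteq> carrier G" "F \<subseteq> carrier G" "H - C \<subseteq> carrier G"
    using CH E F Hc by auto
  have Dinv: "set_inv (H - C) = H - set_inv C"
    using set_inv_Diff[OF Hc subs(1)] set_inv_subgroup[OF H] by simp
  have CHinv: "set_inv C \<subseteq> H" using set_inv_mono[OF CH] set_inv_subgroup[OF H] by simp
  have Finv: "set_inv F \<subset> H - set_inv C"
    using F set_inv_mono[of F "H - C"] Dinv set_inv_set_inv[OF subs(3)] set_inv_set_inv[OF subs(4)]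
    by auto
  have inj: "inj_on (SET_INV G) (rcosets_within G K S)" if "S \<subseteq> H" for S
  proof (rule inj_onI)
    fix Q Q' assume Q: "Q \<in> rcosets_within G K S" "Q' \<in> rcosets_within G K S" "set_inv Q = set_inv Q'"
    then have "Q \<subseteq> carrier G" "Q' \<subseteq> carrier G" using that Hc by (auto simp: rcosets_within_def)
    then show "Q = Q'" using Q(3) set_inv_set_inv by metis
  qed
  have cards: "card (rcosets_within G K (set_inv S)) = card (rcosets_within G K S)"
    "finite (rcosets_within G K (set_inv S)) \<longleftrightarrow> finite (rcosets_within G K S)" if "S \<subseteq> H" for S
    using rcosets_within_set_inv[OF H K that] inj[OF that]
    by (simp_all add: card_image finite_image_iff)
  have invA: "set_inv ((C - E) \<union> F) = (set_inv C - set_inv E) \<union> set_inv F"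
    using set_inv_Diff[OF subs(1,2)] by (auto simp: SET_INV_def)
  have "\<not> minimal_left_complement G ((C - E) \<union> F) B" for B
    using not_minimal_left_complement[OF H fin K(2) KH CH CK finD cardC E F cardK] .
  moreover have "\<not> minimal_left_complement G ((set_inv C - set_inv E) \<union> set_inv F) B" for B
  proof (rule not_minimal_left_complement[OF H fin K(2) KH CHinv])
    show "union_of_rcosets G K (set_inv C)"
      by (rule union_of_rcosets_set_inv[OF H K CH CK])
    show "finite (rcosets_within G K (H - set_inv C))"
      using cards(2)[of "H - C"] finD Dinv by simp
    show "finite (rcosets_within G K (set_inv C)) \<longrightarrow> card (rcosets_within G K (set_inv C))
        > 2 * card (rcosets H) * card (rcosets_within G K (H - set_inv C))"
      using cards[OF CH] cards[of "H - C"] cardC Dinv by simp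
    show "finite (set_inv E)" using card_set_inv[OF subs(2)] E by simp
    show "set_inv E \<subseteq> set_inv C" using E set_inv_mono by simp
    show "finite K \<longrightarrow> (2 * card (rcosets H) + 1) * card (set_inv E) < card K"
      using card_set_inv[OF subs(2)] cardK by simp
  qed (rule Finv)
  ultimately show ?thesis
    using minimal_left_complement_set_inv invA unfolding is_minimal_complement_def by metis
qed

end

section \<open>Properness of \<open>F\<close> and the size of \<open>K\<close> from the condition on
  \<open>F \<union> X\<close>\<close>

theorem theorem2p10:
  fixes G :: "('a, 'b) monoid_scheme" (structure)
    and H K C E F :: "'a set"
  assumes "group G"
    and "subgroup H G"
    and "finite (rcosets H)"
    and "K \<lhd> (G\<lparr>carrier := H\<rparr>)"
    and "C \<subset> H"
    and "union_of_rcosets G K C"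
    and "union_of_finitely_many_rcosets G K (H - C)"
    (* an infinite number of cosets within C exceeds the finite right-hand side;
       rcosets_within G K (H - C) is always finite here *)
    and "finite (rcosets_within G K C) \<longrightarrow>
           card (rcosets_within G K C) > 2 * card (rcosets H) * card (rcosets_within G K (H - C))"
    and "finite E" and "E \<subseteq> C"
    and "F \<subseteq> H - C"
  shows
    "((set_inv C <#> (H - C)) \<union> (set_inv (H - C) <#> C) = H - K
      \<and> (\<forall>X. X \<subseteq> H \<and> finite X \<and> card X \<le> 2 * (card (rcosets H) + 1) * card E
             \<longrightarrow> rcosets_within G K (F \<union> X) = {})
      \<and> rcosets_within G K (E <#> set_inv F) = {}
      \<longrightarrow> \<not> is_minimal_complement G ((C - E) \<union> F))
    \<and>
     ((\<forall>K'. subgroup K' (G\<lparr>carrier := H\<rparr>) \<and> K \<subseteq> K' \<and> union_of_rcosets G K' (H - C)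
             \<longrightarrow> K' \<lhd> (G\<lparr>carrier := H\<rparr>))
      \<and> (\<forall>X. X \<subseteq> H \<and> finite X \<and> card X \<le> 2 * (card (rcosets H) + 1) * card E
             \<longrightarrow> rcosets_within G K (F \<union> X) = {})
      \<and> rcosets_within G K (E <#> set_inv F) = {}
      \<longrightarrow> \<not> is_minimal_complement G ((C - E) \<union> F))"
proof -
  interpret group G by fact
  have KH: "K \<subseteq> H" and KsH: "subgroup K (G\<lparr>carrier := H\<rparr>)"
    using normal_imp_subgroup[OF assms(4)] subgroup.subset by force+
  have K: "subgroup K G" using incl_subgroup[OF assms(2) KsH] .
  have Hc: "H \<subseteq> carrier G" using assms(2) by (rule subgroup.subset)
  have "\<not> is_minimal_complement G ((C - E) \<union> F)"
    if no: "\<forall>X. X \<subseteq> H \<and> finite X \<and> card X \<le> 2 * (card (rcosets H) + 1) * card E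
             \<longrightarrow> rcosets_within G K (F \<union> X) = {}"
  proof (rule not_is_minimal_complement[OF assms(2,3,4) K KH])
    \<comment> \<open>Taking X empty, \<open>F\<close> contains no coset of \<open>K\<close>,
      whereas \<open>H - C\<close> is a nonempty union of cosets.\<close>
    show "F \<subset> H - C"
    proof -
      have "rcosets_within G K F = {}" using no[rule_format, of "{}"] by simp
      moreover obtain \<R> where R: "\<R> \<subseteq> rcosets K" "H - C = \<Union>\<R>"
        using assms(7) unfolding union_of_finitely_many_rcosets_def by auto
      moreover obtain Q where "Q \<in> \<R>" using R assms(5) by blast
      ultimately have "F \<noteq> H - C" by (auto simp: rcosets_within_def)
      then show ?thesis using assms(11) by auto
    qed
    \<comment> \<open>Otherwise X = \<open>K\<close> is small enough, as 2*n + 1 \<le> 2*(n + 1) for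
      the index n, and \<open>F \<union> K\<close> contains the coset \<open>K\<close>.\<close>
    show "finite K \<longrightarrow> (2 * card (rcosets H) + 1) * card E < card K"
    proof (intro impI, rule ccontr)
      assume "finite K" "\<not> (2 * card (rcosets H) + 1) * card E < card K"
      then have "rcosets_within G K (F \<union> K) = {}"
        using no KH by (auto simp: algebra_simps)
      moreover have "K \<in> rcosets K"
        unfolding RCOSETS_def using coset_mult_one[OF subgroup.subset[OF K]] by blast
      ultimately show False by (auto simp: rcosets_within_def)
    qed
  qed (use assms finite_rcosets_within[OF K] in auto)
  then show ?thesis by blast
qed

end
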